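(* Let $X$ be a smooth projective complex curve of genus $g\ge 1$, $N$ a line bundle on $X$, $b\ge 1$ and $c\geq 0$ integers, $\delta\in\mathbb{Q}_{>0}$, and let $(E,\varphi)$ be a decorated vector bundle of type $(2,b,c,N)$ on $X$, i.e. $E$ is a vector bundle on $X$ and $\varphi\colon (E\otimes E)^{\oplus b}\to(\det E)^{\otimes c}\otimes N$ is a nonzero morphism of vector bundles. Then: (semistable version) $(E,\varphi)$ is semistable if and only if $P(E^\bullet,\underline 1)+\delta\,\mu(E^\bullet,\underline 1;\varphi)\ge 0$ for every filtration $E^\bullet$ of $E$ of length at most $2$, where $\underline 1$ denotes the weight vector with all entries equal to $1$; (stable version) $(E,\varphi)$ is stable if and only if $P(E^\bullet,\underline 1)+\delta\,\mu(E^\bullet,\underline 1;\varphi)> 0$ for every filtration $E^\bullet$ of $E$ of length at most $2$.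
   Context: Let $r=\mathrm{rk}(E)$ and $d=\deg(E)$. A weighted filtration $(E^\bullet,\underline\alpha)$ of $E$ of length $t\ge 1$ consists of a chain of subbundles $0\subsetneq E_1\subsetneq\cdots\subsetneq E_t\subsetneq E$ together with a vector $\underline\alpha=(\alpha_1,\dots,\alpha_t)$ of positive rational weights. Put $E_{t+1}=E$, $r_i=\mathrm{rk}(E_i)$, $d_i=\deg(E_i)$. Define $$P(E^\bullet,\underline\alpha)=\sum_{i=1}^t\alpha_i\,(d\,r_i-r\,d_i),$$ $$\gamma=\sum_{i=1}^t\alpha_i\,(\underbrace{r_i-r,\dots,r_i-r}_{r_i\text{ times}},\underbrace{r_i,\dots,r_i}_{r-r_i\text{ times}})\in\mathbb{Q}^r,$$ and let $\gamma^{(i)}$, for $i\in\{1,\dots,t+1\}$, denote the $r_i$-th entry of $\gamma$. Define $$\mu(E^\bullet,\underline\alpha;\varphi)=-\min_{i,j\in\{1,\dots,t+1\}}\{\gamma^{(i)}+\gamma^{(j)}\;:\;\varphi|_{(E_i\otimes E_j)^{\oplus b}}\not\equiv 0\}.$$ The decorated bundle $(E,\varphi)$ is called semistable (respectively stable), with respect to the fixed parameter $\delta$, if $P(E^\bullet,\underline\alpha)+\delta\,\mu(E^\bullet,\underline\alpha;\varphi)\ge 0$ (respectively $>0$) for every weighted filtration $(E^\bullet,\underline\alpha)$ of $E$ of any length. *)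

theory Defs
  imports
    "HOL-Analysis.Abstract_Topology"
    "HOL-Library.Extended_Nat"
    "Jordan_Normal_Form.VS_Connect"
begin

section \<open>Spaces with functions\<close>

text \<open>
  A classical variety is treated as a topological space together with its sheaf of regular
  complex-valued functions. Only the values on \<open>U\<close> of the members of \<open>reg S U\<close> matter.
\<close>

record 'p fun_space =
  topo :: "'p topology"
  reg :: "'p set \<Rightarrow> ('p \<Rightarrow> complex) set"

definition regular_mat :: "'p fun_space \<Rightarrow> 'p set \<Rightarrow> nat \<Rightarrow> nat \<Rightarrow> ('p \<Rightarrow> complex mat) \<Rightarrow> bool" where
  "regular_mat S U k l A \<longleftrightarrow>
     (\<forall>x\<in>U. A x \<in> carrier_mat k l) \<and> (\<forall>i<k. \<forall>j<l. (\<lambda>x. A x $$ (i, j)) \<in> reg S U)"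

definition regular_at :: "'p fun_space \<Rightarrow> 'p \<Rightarrow> ('p \<Rightarrow> complex) \<Rightarrow> bool" where
  "regular_at S x f \<longleftrightarrow> (\<exists>W. openin (topo S) W \<and> x \<in> W \<and> f \<in> reg S W)"

text \<open>\<open>t\<close> generates the maximal ideal of the local ring at \<open>x\<close>.\<close>

definition uniformizer :: "'p fun_space \<Rightarrow> 'p \<Rightarrow> ('p \<Rightarrow> complex) \<Rightarrow> bool" where
  "uniformizer S x t \<longleftrightarrow> regular_at S x t \<and> t x = 0 \<and>
     (\<forall>f. regular_at S x f \<and> f x = 0 \<longrightarrow>
        (\<exists>h W. regular_at S x h \<and> openin (topo S) W \<and> x \<in> W \<and> (\<forall>y\<in>W. f y = t y * h y)))"

text \<open>
  The order of vanishing at \<open>x\<close> of a nonzero rational function, given by its values on a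
  punctured neighbourhood of \<open>x\<close>.
\<close>

definition vanishing_order :: "'p fun_space \<Rightarrow> 'p \<Rightarrow> ('p \<Rightarrow> complex) \<Rightarrow> int" where
  "vanishing_order S x f = (THE k. \<exists>t u W. uniformizer S x t \<and> regular_at S x u \<and> u x \<noteq> 0 \<and>
     openin (topo S) W \<and> x \<in> W \<and> (\<forall>y\<in>W - {x}. f y = t y powi k * u y))"

definition irreducible_closed :: "'p topology \<Rightarrow> 'p set \<Rightarrow> bool" where
  "irreducible_closed T Z \<longleftrightarrow> closedin T Z \<and> Z \<noteq> {} \<and>
     (\<forall>A B. closedin T A \<and> closedin T B \<and> Z = A \<union> B \<longrightarrow> Z = A \<or> Z = B)"

definition krull_dim :: "'p topology \<Rightarrow> enat" where
  "krull_dim T = Sup {enat k |k. \<exists>Z. (\<forall>i\<le>k. irreducible_closed T (Z i)) \<and>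
                                     (\<forall>i<k. Z i \<subset> Z (Suc i))}"


section \<open>Smooth projective curves\<close>

text \<open>
  Points of projective \<open>n\<close>-space are lines in complex \<open>(n+1)\<close>-space with the origin removed.
  Polynomials are identified with polynomial functions.
\<close>

type_synonym ppoint = "complex vec set"

definition proj_space :: "nat \<Rightarrow> ppoint set" where
  "proj_space n = {{c \<cdot>\<^sub>v v |c. c \<noteq> 0} |v. v \<in> carrier_vec (Suc n) \<and> v \<noteq> 0\<^sub>v (Suc n)}"

definition homogeneous_poly :: "nat \<Rightarrow> nat \<Rightarrow> (complex vec \<Rightarrow> complex) \<Rightarrow> bool" where
  "homogeneous_poly n d f \<longleftrightarrow> (\<exists>a :: (nat \<Rightarrow> nat) \<Rightarrow> complex.
     f = (\<lambda>v. \<Sum>m | (\<forall>i>n. m i = 0) \<and> (\<Sum>i\<le>n. m i) = d. a m * (\<Prod>i\<le>n. v $ i ^ m i)))"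

text \<open>The sets \<open>f \<noteq> 0\<close> form a basis of the Zariski topology.\<close>

definition zariski :: "nat \<Rightarrow> ppoint topology" where
  "zariski n = topology_generated_by
     {{p \<in> proj_space n. \<forall>v\<in>p. f v \<noteq> 0} |f. \<exists>d. homogeneous_poly n d f}"

definition proj_variety :: "nat \<Rightarrow> ppoint set \<Rightarrow> ppoint fun_space" where
  "proj_variety n X = \<lparr>
     topo = subtopology (zariski n) X,
     reg = (\<lambda>U. {f. \<forall>p\<in>U. \<exists>W d g h. openin (subtopology (zariski n) X) W \<and> p \<in> W \<and>
                  homogeneous_poly n d g \<and> homogeneous_poly n d h \<and>
                  (\<forall>q\<in>W. \<forall>v\<in>q. h v \<noteq> 0 \<and> f q = g v / h v)})\<rparr>"

text \<open>
  The tangent space at \<open>v\<close> of the affine cone over \<open>X\<close>, that is, the kernel at \<open>v\<close> of the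
  Jacobian of the homogeneous ideal of \<open>X\<close>.
\<close>

definition cone_tangent_space :: "nat \<Rightarrow> ppoint set \<Rightarrow> complex vec \<Rightarrow> complex vec set" where
  "cone_tangent_space n X v = {w \<in> carrier_vec (Suc n).
     \<forall>d f. homogeneous_poly n d f \<and> (\<forall>p\<in>X. \<forall>u\<in>p. f u = 0) \<longrightarrow>
       ((\<lambda>s. f (v + s \<cdot>\<^sub>v w)) has_field_derivative 0) (at 0)}"

text \<open>Smoothness is the Jacobian criterion: the cone over a curve has dimension 2.\<close>

definition smooth_projective_curve :: "nat \<Rightarrow> ppoint set \<Rightarrow> bool" where
  "smooth_projective_curve n X \<longleftrightarrow>
     irreducible_closed (zariski n) X \<and>
     krull_dim (subtopology (zariski n) X) = 1 \<and>
     (\<forall>p\<in>X. \<forall>v\<in>p. vectorspace.dim class_ring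
        ((module_vec TYPE(complex) (Suc n))\<lparr>carrier := cone_tangent_space n X v\<rparr>) = 2)"

text \<open>
  The genus is the dimension of the first cohomology of the structure sheaf, computed as Cech
  cohomology of the standard affine cover. Dimension \<open>g\<close> is witnessed by \<open>g\<close> cocycles whose
  classes form a basis.
\<close>

definition std_chart :: "ppoint set \<Rightarrow> nat \<Rightarrow> ppoint set" where
  "std_chart X i = {p \<in> X. \<forall>v\<in>p. v $ i \<noteq> 0}"

definition cech_cocycle :: "nat \<Rightarrow> ppoint set \<Rightarrow> (nat \<Rightarrow> nat \<Rightarrow> ppoint \<Rightarrow> complex) \<Rightarrow> bool" where
  "cech_cocycle n X z \<longleftrightarrow>
     (\<forall>i\<le>n. \<forall>j\<le>n. z i j \<in> reg (proj_variety n X) (std_chart X i \<inter> std_chart X j)) \<and>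
     (\<forall>i\<le>n. \<forall>j\<le>n. \<forall>k\<le>n. \<forall>x \<in> std_chart X i \<inter> std_chart X j \<inter> std_chart X k.
        z i j x + z j k x = z i k x)"

definition cech_coboundary :: "nat \<Rightarrow> ppoint set \<Rightarrow> (nat \<Rightarrow> nat \<Rightarrow> ppoint \<Rightarrow> complex) \<Rightarrow> bool" where
  "cech_coboundary n X z \<longleftrightarrow>
     (\<exists>h. (\<forall>i\<le>n. h i \<in> reg (proj_variety n X) (std_chart X i)) \<and>
          (\<forall>i\<le>n. \<forall>j\<le>n. \<forall>x \<in> std_chart X i \<inter> std_chart X j. z i j x = h j x - h i x))"

definition has_genus :: "nat \<Rightarrow> ppoint set \<Rightarrow> nat \<Rightarrow> bool" where
  "has_genus n X g \<longleftrightarrow> (\<exists>z :: nat \<Rightarrow> nat \<Rightarrow> nat \<Rightarrow> ppoint \<Rightarrow> complex.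
     (\<forall>k<g. cech_cocycle n X (z k)) \<and>
     (\<forall>y. cech_cocycle n X y \<longrightarrow>
        (\<exists>a. cech_coboundary n X (\<lambda>i j x. y i j x - (\<Sum>k<g. a k * z k i j x)))) \<and>
     (\<forall>a. cech_coboundary n X (\<lambda>i j x. \<Sum>k<g. a k * z k i j x) \<longrightarrow> (\<forall>k<g. a k = 0)))"


section \<open>Vector bundles\<close>

text \<open>
  A vector bundle is given by a trivialising open cover and regular transition matrices. A point
  of the fibre at \<open>x\<close> is a family of vectors \<open>v i\<close>, one for each chart containing \<open>x\<close>, with
  \<open>v i = transition E i j x *\<^sub>v v j\<close>.
\<close>

record ('i, 'p) vbundle =
  rk :: nat
  idx :: "'i set"
  chart :: "'i \<Rightarrow> 'p set"
  transition :: "'i \<Rightarrow> 'i \<Rightarrow> 'p \<Rightarrow> complex mat"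

definition vector_bundle :: "'p fun_space \<Rightarrow> ('i, 'p) vbundle \<Rightarrow> bool" where
  "vector_bundle S E \<longleftrightarrow>
     (\<forall>i\<in>idx E. openin (topo S) (chart E i)) \<and>
     (\<Union>i\<in>idx E. chart E i) = topspace (topo S) \<and>
     (\<forall>i\<in>idx E. \<forall>j\<in>idx E.
        regular_mat S (chart E i \<inter> chart E j) (rk E) (rk E) (transition E i j)) \<and>
     (\<forall>i\<in>idx E. \<forall>x\<in>chart E i. transition E i i x = 1\<^sub>m (rk E)) \<and>
     (\<forall>i\<in>idx E. \<forall>j\<in>idx E. \<forall>k\<in>idx E. \<forall>x \<in> chart E i \<inter> chart E j \<inter> chart E k.
        transition E i j x * transition E j k x = transition E i k x)"

definition line_bundle :: "'p fun_space \<Rightarrow> ('i, 'p) vbundle \<Rightarrow> bool" where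
  "line_bundle S L \<longleftrightarrow> vector_bundle S L \<and> rk L = 1"

definition det_bundle :: "('i, 'p) vbundle \<Rightarrow> ('i, 'p) vbundle" where
  "det_bundle E = E\<lparr>rk := 1, transition := (\<lambda>i j x. mat 1 1 (\<lambda>_. det (transition E i j x)))\<rparr>"

text \<open>The basis vector \<open>e\<^sub>k \<otimes> e\<^sub>l\<close> of a tensor product has index \<open>k * dim + l\<close>.\<close>

definition kronecker_vec :: "complex vec \<Rightarrow> complex vec \<Rightarrow> complex vec" where
  "kronecker_vec v w =
     vec (dim_vec v * dim_vec w) (\<lambda>k. v $ (k div dim_vec w) * w $ (k mod dim_vec w))"

definition kronecker_mat :: "complex mat \<Rightarrow> complex mat \<Rightarrow> complex mat" where
  "kronecker_mat A B = mat (dim_row A * dim_row B) (dim_col A * dim_col B)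
     (\<lambda>(k, l). A $$ (k div dim_row B, l div dim_col B) * B $$ (k mod dim_row B, l mod dim_col B))"

definition tensor_bundle :: "('i, 'p) vbundle \<Rightarrow> ('j, 'p) vbundle \<Rightarrow> ('i \<times> 'j, 'p) vbundle" where
  "tensor_bundle E F = \<lparr>
     rk = rk E * rk F,
     idx = idx E \<times> idx F,
     chart = (\<lambda>(i, j). chart E i \<inter> chart F j),
     transition = (\<lambda>(i, j) (k, l) x. kronecker_mat (transition E i k x) (transition F j l x))\<rparr>"

definition tensor_power_bundle :: "nat \<Rightarrow> ('i, 'p) vbundle \<Rightarrow> ('i, 'p) vbundle" where
  "tensor_power_bundle c E = E\<lparr>
     rk := rk E ^ c,
     transition := (\<lambda>i j x. (kronecker_mat (transition E i j x) ^^ c) (1\<^sub>m 1))\<rparr>"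

definition copies_bundle :: "nat \<Rightarrow> ('i, 'p) vbundle \<Rightarrow> ('i, 'p) vbundle" where
  "copies_bundle b E = E\<lparr>
     rk := b * rk E,
     transition := (\<lambda>i j x. diag_block_mat (replicate b (transition E i j x)))\<rparr>"

definition bundle_morphism ::
  "'p fun_space \<Rightarrow> ('i, 'p) vbundle \<Rightarrow> ('j, 'p) vbundle \<Rightarrow> ('i \<Rightarrow> 'j \<Rightarrow> 'p \<Rightarrow> complex mat) \<Rightarrow> bool" where
  "bundle_morphism S E F \<phi> \<longleftrightarrow>
     (\<forall>i\<in>idx E. \<forall>j\<in>idx F. regular_mat S (chart E i \<inter> chart F j) (rk F) (rk E) (\<phi> i j)) \<and>
     (\<forall>i\<in>idx E. \<forall>i'\<in>idx E. \<forall>j\<in>idx F. \<forall>j'\<in>idx F.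
        \<forall>x \<in> chart E i \<inter> chart E i' \<inter> chart F j \<inter> chart F j'.
        \<phi> i' j' x * transition E i' i x = transition F j' j x * \<phi> i j x)"

text \<open>
  For a line bundle: \<open>s\<close> is a regular nowhere vanishing section over the open set \<open>V\<close>, written in
  the charts. A nonzero rational section on an irreducible curve has this form after shrinking
  its domain.
\<close>

definition frame_section ::
  "'p fun_space \<Rightarrow> ('i, 'p) vbundle \<Rightarrow> 'p set \<Rightarrow> ('i \<Rightarrow> 'p \<Rightarrow> complex) \<Rightarrow> bool" where
  "frame_section S L V s \<longleftrightarrow> openin (topo S) V \<and> V \<noteq> {} \<and>
     (\<forall>i\<in>idx L. s i \<in> reg S (chart L i \<inter> V) \<and> (\<forall>x \<in> chart L i \<inter> V. s i x \<noteq> 0)) \<and>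
     (\<forall>i\<in>idx L. \<forall>j\<in>idx L. \<forall>x \<in> chart L i \<inter> chart L j \<inter> V.
        s i x = transition L i j x $$ (0, 0) * s j x)"

definition line_degree :: "'p fun_space \<Rightarrow> ('i, 'p) vbundle \<Rightarrow> int" where
  "line_degree S L = (THE d. \<exists>V s. frame_section S L V s \<and>
     d = (\<Sum>x \<in> topspace (topo S) - V. vanishing_order S x (s (SOME i. i \<in> idx L \<and> x \<in> chart L i))))"

definition bundle_degree :: "'p fun_space \<Rightarrow> ('i, 'p) vbundle \<Rightarrow> int" where
  "bundle_degree S E = line_degree S (det_bundle E)"


section \<open>Subbundles\<close>

text \<open>
  A family of subsets \<open>F i x\<close> of the fibres of \<open>E\<close>, written in the charts; only the values for
  \<open>i \<in> idx E\<close> and \<open>x \<in> chart E i\<close> matter.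
\<close>

type_synonym ('i, 'p) subfamily = "'i \<Rightarrow> 'p \<Rightarrow> complex vec set"

text \<open>Over \<open>U\<close>, the columns of \<open>f\<close> are a basis of \<open>F\<close> consisting of regular sections of \<open>E\<close>.\<close>

definition local_frame ::
  "'p fun_space \<Rightarrow> ('i, 'p) vbundle \<Rightarrow> ('i, 'p) subfamily \<Rightarrow> nat \<Rightarrow>
   'i \<times> 'p set \<times> ('p \<Rightarrow> complex mat) \<Rightarrow> bool" where
  "local_frame S E F m = (\<lambda>(i, U, f).
     i \<in> idx E \<and> openin (topo S) U \<and> U \<subseteq> chart E i \<and> regular_mat S U (rk E) m f \<and>
     (\<forall>x\<in>U. F i x = {f x *\<^sub>v c |c. c \<in> carrier_vec m} \<and>
             (\<forall>c\<in>carrier_vec m. f x *\<^sub>v c = 0\<^sub>v (rk E) \<longrightarrow> c = 0\<^sub>v m)))"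

definition subbundle_of_rank ::
  "'p fun_space \<Rightarrow> ('i, 'p) vbundle \<Rightarrow> ('i, 'p) subfamily \<Rightarrow> nat \<Rightarrow> bool" where
  "subbundle_of_rank S E F m \<longleftrightarrow>
     (\<forall>i\<in>idx E. \<forall>x\<in>chart E i. \<exists>U f. x \<in> U \<and> local_frame S E F m (i, U, f)) \<and>
     (\<forall>i\<in>idx E. \<forall>j\<in>idx E. \<forall>x \<in> chart E i \<inter> chart E j.
        F i x = (\<lambda>v. transition E i j x *\<^sub>v v) ` F j x)"

definition subbundle :: "'p fun_space \<Rightarrow> ('i, 'p) vbundle \<Rightarrow> ('i, 'p) subfamily \<Rightarrow> bool" where
  "subbundle S E F \<longleftrightarrow> (\<exists>m. subbundle_of_rank S E F m)"

definition sub_rank :: "'p fun_space \<Rightarrow> ('i, 'p) vbundle \<Rightarrow> ('i, 'p) subfamily \<Rightarrow> nat" where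
  "sub_rank S E F = (THE m. subbundle_of_rank S E F m)"

text \<open>A subbundle as a vector bundle in its own right, with all its local frames as charts.\<close>

definition sub_vbundle ::
  "'p fun_space \<Rightarrow> ('i, 'p) vbundle \<Rightarrow> ('i, 'p) subfamily \<Rightarrow>
   ('i \<times> 'p set \<times> ('p \<Rightarrow> complex mat), 'p) vbundle" where
  "sub_vbundle S E F = \<lparr>
     rk = sub_rank S E F,
     idx = {u. local_frame S E F (sub_rank S E F) u},
     chart = (\<lambda>(i, U, f). U),
     transition = (\<lambda>(i, U, f) (j, V, h) x.
        THE A. A \<in> carrier_mat (sub_rank S E F) (sub_rank S E F) \<and>
               f x * A = transition E i j x * h x)\<rparr>"

definition sub_degree :: "'p fun_space \<Rightarrow> ('i, 'p) vbundle \<Rightarrow> ('i, 'p) subfamily \<Rightarrow> int" where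
  "sub_degree S E F = bundle_degree S (sub_vbundle S E F)"

definition zero_sub :: "('i, 'p) vbundle \<Rightarrow> ('i, 'p) subfamily" where
  "zero_sub E = (\<lambda>i x. {0\<^sub>v (rk E)})"

definition full_sub :: "('i, 'p) vbundle \<Rightarrow> ('i, 'p) subfamily" where
  "full_sub E = (\<lambda>i x. carrier_vec (rk E))"

definition sub_le :: "('i, 'p) vbundle \<Rightarrow> ('i, 'p) subfamily \<Rightarrow> ('i, 'p) subfamily \<Rightarrow> bool" where
  "sub_le E F G \<longleftrightarrow> (\<forall>i\<in>idx E. \<forall>x\<in>chart E i. F i x \<subseteq> G i x)"

definition sub_less :: "('i, 'p) vbundle \<Rightarrow> ('i, 'p) subfamily \<Rightarrow> ('i, 'p) subfamily \<Rightarrow> bool" where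
  "sub_less E F G \<longleftrightarrow> sub_le E F G \<and> \<not> sub_le E G F"

definition tensor_sub ::
  "('i, 'p) vbundle \<Rightarrow> ('j, 'p) vbundle \<Rightarrow> ('i, 'p) subfamily \<Rightarrow> ('j, 'p) subfamily \<Rightarrow>
   ('i \<times> 'j, 'p) subfamily" where
  "tensor_sub E E' F G = (\<lambda>(i, j) x.
     LinearCombinations.module.span class_ring (module_vec TYPE(complex) (rk E * rk E'))
       {kronecker_vec v w |v w. v \<in> F i x \<and> w \<in> G j x})"

definition copies_sub :: "nat \<Rightarrow> ('i, 'p) vbundle \<Rightarrow> ('i, 'p) subfamily \<Rightarrow> ('i, 'p) subfamily" where
  "copies_sub b E F = (\<lambda>i x. {v \<in> carrier_vec (b * rk E).
     \<forall>k<b. vec (rk E) (\<lambda>l. v $ (k * rk E + l)) \<in> F i x})"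

definition nonzero_on ::
  "('i, 'p) vbundle \<Rightarrow> ('j, 'p) vbundle \<Rightarrow> ('i \<Rightarrow> 'j \<Rightarrow> 'p \<Rightarrow> complex mat) \<Rightarrow>
   ('i, 'p) subfamily \<Rightarrow> bool" where
  "nonzero_on E F \<phi> G \<longleftrightarrow>
     (\<exists>i\<in>idx E. \<exists>j\<in>idx F. \<exists>x \<in> chart E i \<inter> chart F j. \<exists>v \<in> G i x. \<phi> i j x *\<^sub>v v \<noteq> 0\<^sub>v (rk F))"


section \<open>Decorated bundles and semistability\<close>

abbreviation decoration_source :: "nat \<Rightarrow> ('i, 'p) vbundle \<Rightarrow> ('i \<times> 'i, 'p) vbundle" where
  "decoration_source b E \<equiv> copies_bundle b (tensor_bundle E E)"

abbreviation decoration_target ::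
  "nat \<Rightarrow> ('j, 'p) vbundle \<Rightarrow> ('i, 'p) vbundle \<Rightarrow> ('i \<times> 'j, 'p) vbundle" where
  "decoration_target c N E \<equiv> tensor_bundle (tensor_power_bundle c (det_bundle E)) N"

type_synonym ('i, 'j, 'p) decoration = "'i \<times> 'i \<Rightarrow> 'i \<times> 'j \<Rightarrow> 'p \<Rightarrow> complex mat"

definition decorated_bundle ::
  "'p fun_space \<Rightarrow> nat \<Rightarrow> nat \<Rightarrow> ('j, 'p) vbundle \<Rightarrow> ('i, 'p) vbundle \<Rightarrow> ('i, 'j, 'p) decoration \<Rightarrow> bool" where
  "decorated_bundle S b c N E \<phi> \<longleftrightarrow> vector_bundle S E \<and>
     bundle_morphism S (decoration_source b E) (decoration_target c N E) \<phi> \<and>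
     nonzero_on (decoration_source b E) (decoration_target c N E) \<phi> (full_sub (decoration_source b E))"

text \<open>A filtration of length \<open>t\<close> is \<open>F 1, \<dots>, F t\<close>, padded by \<open>F 0 = 0\<close> and \<open>F (t + 1) = E\<close>.\<close>

definition filtration ::
  "'p fun_space \<Rightarrow> ('i, 'p) vbundle \<Rightarrow> nat \<Rightarrow> (nat \<Rightarrow> ('i, 'p) subfamily) \<Rightarrow> bool" where
  "filtration S E t F \<longleftrightarrow> t \<ge> 1 \<and> F 0 = zero_sub E \<and> F (Suc t) = full_sub E \<and>
     (\<forall>i\<in>{1..t}. subbundle S E (F i)) \<and> (\<forall>i\<le>t. sub_less E (F i) (F (Suc i)))"

definition weighted_filtration ::
  "'p fun_space \<Rightarrow> ('i, 'p) vbundle \<Rightarrow> nat \<Rightarrow> (nat \<Rightarrow> ('i, 'p) subfamily) \<Rightarrow> (nat \<Rightarrow> rat) \<Rightarrow> bool" where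
  "weighted_filtration S E t F \<alpha> \<longleftrightarrow> filtration S E t F \<and> (\<forall>i\<in>{1..t}. \<alpha> i > 0)"

definition P_filt ::
  "'p fun_space \<Rightarrow> ('i, 'p) vbundle \<Rightarrow> nat \<Rightarrow> (nat \<Rightarrow> ('i, 'p) subfamily) \<Rightarrow> (nat \<Rightarrow> rat) \<Rightarrow> rat" where
  "P_filt S E t F \<alpha> = (\<Sum>i=1..t. \<alpha> i *
     of_int (bundle_degree S E * int (sub_rank S E (F i)) - int (rk E) * sub_degree S E (F i)))"

text \<open>The \<open>l\<close>-th entry of the vector \<open>\<gamma>\<close>, with entries numbered \<open>1, \<dots>, rk E\<close>.\<close>

definition gamma_entry ::
  "'p fun_space \<Rightarrow> ('i, 'p) vbundle \<Rightarrow> nat \<Rightarrow> (nat \<Rightarrow> ('i, 'p) subfamily) \<Rightarrow> (nat \<Rightarrow> rat) \<Rightarrow> nat \<Rightarrow> rat" where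
  "gamma_entry S E t F \<alpha> l = (\<Sum>i=1..t. \<alpha> i *
     (if l \<le> sub_rank S E (F i) then of_nat (sub_rank S E (F i)) - of_nat (rk E)
      else of_nat (sub_rank S E (F i))))"

definition mu_filt ::
  "'p fun_space \<Rightarrow> nat \<Rightarrow> nat \<Rightarrow> ('j, 'p) vbundle \<Rightarrow> ('i, 'p) vbundle \<Rightarrow> ('i, 'j, 'p) decoration \<Rightarrow>
   nat \<Rightarrow> (nat \<Rightarrow> ('i, 'p) subfamily) \<Rightarrow> (nat \<Rightarrow> rat) \<Rightarrow> rat" where
  "mu_filt S b c N E \<phi> t F \<alpha> = - Min
     {gamma_entry S E t F \<alpha> (sub_rank S E (F i)) + gamma_entry S E t F \<alpha> (sub_rank S E (F j)) |i j.
        i \<in> {1..Suc t} \<and> j \<in> {1..Suc t} \<and>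
        nonzero_on (decoration_source b E) (decoration_target c N E) \<phi>
          (copies_sub b (tensor_bundle E E) (tensor_sub E E (F i) (F j)))}"

definition semistable_decorated ::
  "'p fun_space \<Rightarrow> rat \<Rightarrow> nat \<Rightarrow> nat \<Rightarrow> ('j, 'p) vbundle \<Rightarrow> ('i, 'p) vbundle \<Rightarrow> ('i, 'j, 'p) decoration \<Rightarrow> bool" where
  "semistable_decorated S \<delta> b c N E \<phi> \<longleftrightarrow> (\<forall>t F \<alpha>. weighted_filtration S E t F \<alpha> \<longrightarrow>
     P_filt S E t F \<alpha> + \<delta> * mu_filt S b c N E \<phi> t F \<alpha> \<ge> 0)"

definition stable_decorated ::
  "'p fun_space \<Rightarrow> rat \<Rightarrow> nat \<Rightarrow> nat \<Rightarrow> ('j, 'p) vbundle \<Rightarrow> ('i, 'p) vbundle \<Rightarrow> ('i, 'j, 'p) decoration \<Rightarrow> bool" where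
  "stable_decorated S \<delta> b c N E \<phi> \<longleftrightarrow> (\<forall>t F \<alpha>. weighted_filtration S E t F \<alpha> \<longrightarrow>
     P_filt S E t F \<alpha> + \<delta> * mu_filt S b c N E \<phi> t F \<alpha> > 0)"

end

theory Submission
  imports Defs
begin

text \<open>
  Fix a filtration and write \<open>A i = (\<Sum>k\<ge>i. \<alpha> k)\<close>. Since the ranks of the members are strictly
  increasing, \<open>\<mu>\<close> is, up to a linear term in \<open>\<alpha>\<close>, the maximum of \<open>r * (A i + A j)\<close> over the pairs
  \<open>(i, j)\<close> on which \<open>\<phi>\<close> does not vanish. Let \<open>(p, q)\<close> attain it. On the cone of weights for which
  \<open>(p, q)\<close> is maximal, \<open>P + \<delta> \<mu>\<close> is linear, and every element of this cone is a positive combination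
  of indicator vectors of sets with at most two elements which again lie in the cone. The value at
  such an indicator vector is at least the value of the corresponding subfiltration of length at
  most two with unit weights.
\<close>

section \<open>Decomposition of weights\<close>

text \<open>The sum runs over an arbitrary index set \<open>K\<close>, so that
  \<open>tail_sum I (\<lambda>_. 1)\<close> is the tail sum of the indicator vector of
  \<open>I\<close>: it counts the elements of \<open>I\<close> that are at least
  \<open>x\<close>.\<close>

definition tail_sum :: "'a::linorder set \<Rightarrow> ('a \<Rightarrow> 'b::linordered_field) \<Rightarrow> 'a \<Rightarrow> 'b" where
  "tail_sum K a x = sum a (K \<inter> {x..})"

text \<open>Only the position of \<open>x\<close> and \<open>y\<close> relative to \<open>K\<close>
  matters. The hypothesis also covers \<open>y < x\<close> with no element of \<open>K\<close> in
  between.\<close>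

lemma tail_sum_mono:
  assumes "finite K" "\<forall>k\<in>K. 0 \<le> a k" "\<And>k. k \<in> K \<Longrightarrow> y \<le> k \<Longrightarrow> x \<le> k"
  shows "tail_sum K a y \<le> tail_sum K a x"
  unfolding tail_sum_def using assms by (intro sum_mono2) auto

text \<open>The weights of \<open>J\<close> are counted at \<open>x\<close> and no longer at
  \<open>y\<close>. Nonemptiness of \<open>J\<close> forces \<open>x \<le> y\<close>.\<close>

lemma tail_sum_gap:
  assumes "finite K" "\<forall>k\<in>K. 0 \<le> a k"
    and "J \<subseteq> K" "J \<noteq> {}" "\<And>k. k \<in> J \<Longrightarrow> x \<le> k \<and> k < y"
  shows "tail_sum K a y + sum a J \<le> tail_sum K a x"
proof -
  have "x \<le> y" using assms(4,5) by fastforce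
  have fin: "finite J" using assms by (meson finite_subset)
  have "tail_sum K a y + sum a J = sum a ((K \<inter> {y..}) \<union> J)"
    unfolding tail_sum_def using assms fin by (subst sum.union_disjoint) force+
  also have "\<dots> \<le> tail_sum K a x"
    unfolding tail_sum_def using assms \<open>x \<le> y\<close> by (intro sum_mono2) auto
  finally show ?thesis .
qed

lemma tail_sum_diff_indicator:
  assumes "finite K" "I \<subseteq> K"
  shows "tail_sum K (\<lambda>k. a k - (if k \<in> I then e else 0)) x = tail_sum K a x - e * tail_sum I (\<lambda>_. 1) x"
proof -
  have "(\<Sum>k\<in>K \<inter> {x..}. if k \<in> I then e else 0) = e * of_nat (card (I \<inter> {x..}))"
    using assms by (simp add: sum.If_cases Int_absorb1 Int_ac) (metis Int_absorb1 Int_commute Int_left_commute)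
  then show ?thesis
    unfolding tail_sum_def sum_subtractf by simp
qed

lemma tail_sum_one_single: "tail_sum {u} (\<lambda>_. 1) x = (if x \<le> u then 1 else 0)"
  by (simp add: tail_sum_def)

lemma tail_sum_one_pair:
  assumes "u \<noteq> v"
  shows "tail_sum {u, v} (\<lambda>_. 1) x = (if x \<le> u then 1 else 0) + (if x \<le> v then 1 else 0)"
  using assms by (simp add: tail_sum_def)

text \<open>
  A multiple of the indicator of \<open>I\<close> can be split off without leaving the cone where \<open>(p, q)\<close>
  dominates \<open>T\<close>. A pair \<open>{u, v}\<close> consists of an index that can violate a domination inequality when
  taken alone and of one that compensates it; taking them closest to \<open>p\<close> and \<open>q\<close> keeps the remaining
  inequalities intact.
\<close>

lemma peel_step:
  fixes a :: "'a::linorder \<Rightarrow> 'b::linordered_field"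
  defines "N \<equiv> \<lambda>I. tail_sum I (\<lambda>_. 1 :: 'b)"
  assumes fin: "finite K" and ne: "K \<noteq> {}" and pos: "\<And>k. k \<in> K \<Longrightarrow> 0 < a k"
    and pq: "p \<le> q" and ord: "\<And>k l. (k, l) \<in> T \<Longrightarrow> k \<le> l"
    and dom: "\<And>k l. (k, l) \<in> T \<Longrightarrow>
      tail_sum K a k + tail_sum K a l \<le> tail_sum K a p + tail_sum K a q"
  obtains I where "I \<subseteq> K" "I \<noteq> {}" "card I \<le> 2"
    "\<And>k l. (k, l) \<in> T \<Longrightarrow> N I k + N I l \<le> N I p + N I q"
    "\<And>k l e. (k, l) \<in> T \<Longrightarrow> 0 \<le> e \<Longrightarrow> (\<And>i. i \<in> I \<Longrightarrow> e \<le> a i) \<Longrightarrow>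
      tail_sum K a k + tail_sum K a l - e * (N I k + N I l)
        \<le> tail_sum K a p + tail_sum K a q - e * (N I p + N I q)"
proof -
  note result = that
  let ?A = "tail_sum K a"
  have nn: "\<forall>k\<in>K. 0 \<le> a k" using pos by (simp add: less_imp_le)
  note mono = tail_sum_mono[OF fin nn]
  have gap1: "?A y + e \<le> ?A x" if "u \<in> K" "x \<le> u" "u < y" "e \<le> a u" for u x y e
    using tail_sum_gap[OF fin nn, where J = "{u}" and x = x and y = y] that by auto
  have gap2: "?A y + 2 * e \<le> ?A x"
    if "u \<in> K" "v \<in> K" "u \<noteq> v" "x \<le> u" "u < y" "x \<le> v" "v < y" "e \<le> a u" "e \<le> a v" for u v x y e
    using tail_sum_gap[OF fin nn, where J = "{u, v}" and x = x and y = y] that by fastforce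
  \<comment> \<open>In both cases that need a pair, its count at \<open>(p, q)\<close> is 2. Since
    \<open>(k, l)\<close> may count less, a domination inequality can lose up to twice
    \<open>e\<close> in slack; \<open>slack\<close> asks that this much be available.\<close>
  have goal_pair: thesis
    if u: "u \<in> K" and v: "v \<in> K" and "u \<noteq> v"
      and two: "N {u, v} p + N {u, v} q = 2"
      and le2: "\<And>k l. (k, l) \<in> T \<Longrightarrow> N {u, v} k + N {u, v} l \<le> 2"
      and slack: "\<And>k l e. (k, l) \<in> T \<Longrightarrow> 0 \<le> e \<Longrightarrow> e \<le> a u \<Longrightarrow> e \<le> a v \<Longrightarrow>
        ?A k + ?A l + e * (2 - (N {u, v} k + N {u, v} l)) \<le> ?A p + ?A q" for u v
  proof (rule result)
    show "card {u, v} \<le> 2" by (simp add: card_insert_if)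
    show "N {u, v} k + N {u, v} l \<le> N {u, v} p + N {u, v} q" if "(k, l) \<in> T" for k l
      using le2[OF that] two by simp
    show "?A k + ?A l - e * (N {u, v} k + N {u, v} l) \<le> ?A p + ?A q - e * (N {u, v} p + N {u, v} q)"
      if "(k, l) \<in> T" "0 \<le> e" "\<And>i. i \<in> {u, v} \<Longrightarrow> e \<le> a i" for k l e
      using slack[OF that(1,2)] that(3) unfolding two by (simp add: algebra_simps)
  qed (use u v in auto)
  \<comment> \<open>An element \<open>w\<close> of \<open>K\<close> below \<open>p\<close> that is
    still counted at the first entry of some pair of \<open>T\<close> may favour that pair over
    \<open>(p, q)\<close>. \<open>pair_right\<close> says the same of \<open>q\<close> and the
    second entries.\<close>
  define pair_left where "pair_left \<longleftrightarrow> (\<exists>w k l. w \<in> K \<and> w < p \<and> (k, l) \<in> T \<and> k \<le> w)"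
  define pair_right where "pair_right \<longleftrightarrow> (\<exists>w k l. w \<in> K \<and> w < q \<and> (k, l) \<in> T \<and> l \<le> w)"
  consider (outer) pair_left | (inner) pair_right | (free) "\<not> pair_left" "\<not> pair_right" by blast
  then show thesis
  proof cases
    case outer
    then obtain w k l where outer: "w \<in> K" "w < p" "(k, l) \<in> T" "k \<le> w"
      unfolding pair_left_def by auto
    \<comment> \<open>The pair will straddle \<open>p\<close> and \<open>q\<close>: \<open>u\<close>
      is the last element of \<open>K\<close> before \<open>p\<close> and \<open>v\<close> the first
      one from \<open>q\<close> on. Each of \<open>p\<close> and \<open>q\<close> then counts
      \<open>v\<close> only.\<close>
    define u where "u = Max (K \<inter> {..<p})"
    have "K \<inter> {..<p} \<noteq> {}" using outer by auto
    then have u: "u \<in> K" "u < p" and umax: "\<And>x. x \<in> K \<Longrightarrow> x < p \<Longrightarrow> x \<le> u"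
      unfolding u_def using Max_in[of "K \<inter> {..<p}"] Max_ge[of "K \<inter> {..<p}"] fin by auto
    \<comment> \<open>The left entry gains at least \<open>a u\<close> over \<open>p\<close>, so
      domination forces a strict loss on the right, that is, an element of \<open>K\<close> from
      \<open>q\<close> on and before \<open>l\<close>.\<close>
    have ex: "\<exists>x\<in>K. q \<le> x \<and> x < l" if "(k, l) \<in> T" "k \<le> u" for k l
    proof (rule ccontr)
      assume "\<not> ?thesis"
      then have "?A q \<le> ?A l" by (intro mono) auto
      moreover have "?A p + a u \<le> ?A k" using gap1[of u k p "a u"] u that by auto
      ultimately show False using dom[OF that(1)] pos[OF u(1)] by auto
    qed
    define v where "v = Min (K \<inter> {q..})"
    have "K \<inter> {q..} \<noteq> {}" using ex[OF outer(3)] outer umax by fastforce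
    then have v: "v \<in> K" "q \<le> v" and vmin: "\<And>x. x \<in> K \<Longrightarrow> q \<le> x \<Longrightarrow> v \<le> x"
      unfolding v_def using Min_in[of "K \<inter> {q..}"] Min_le[of "K \<inter> {q..}"] fin by auto
    have vT: "v < l" if "(k, l) \<in> T" "k \<le> u" for k l
      using ex[OF that] vmin by fastforce
    have uv: "u < v" using u v pq by auto
    have Nx: "N {u, v} x = (if x \<le> u then 1 else 0) + (if x \<le> v then 1 else 0)" for x
      unfolding N_def using uv by (intro tail_sum_one_pair) auto
    show thesis
    proof (rule goal_pair[of u v])
      show "N {u, v} p + N {u, v} q = 2" using u v pq unfolding Nx by auto
      show "N {u, v} k + N {u, v} l \<le> 2" if "(k, l) \<in> T" for k l
        using vT[OF that] ord[OF that] uv unfolding Nx by auto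
      show "?A k + ?A l + e * (2 - (N {u, v} k + N {u, v} l)) \<le> ?A p + ?A q"
        if "(k, l) \<in> T" "0 \<le> e" "e \<le> a u" "e \<le> a v" for k l e
      proof (cases "k \<le> u")
        case True
        then show ?thesis using vT[OF that(1)] dom[OF that(1)] uv unfolding Nx by auto
      next
        case False
        have kl: "k \<le> l" using ord that by auto
        \<comment> \<open>No element of \<open>K\<close> lies strictly between \<open>u\<close> and
          \<open>p\<close>, so the left entry gains nothing. Each entry beyond \<open>v\<close>
          lowers the count by 1 and leaves a gap of at least \<open>e\<close>.\<close>
        have Ak: "?A k \<le> ?A p" using umax False by (intro mono) (meson le_less_trans not_less)
        consider "l \<le> v" | "k \<le> v" "v < l" | "v < k" by force
        then show ?thesis
        proof cases
          case 1
          then show ?thesis using kl False uv dom[OF that(1)] unfolding Nx by auto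
        next
          case 2
          have "?A l + e \<le> ?A q" using gap1[of v q l e] v 2 that by auto
          then show ?thesis using 2 kl False uv Ak unfolding Nx by auto
        next
          case 3
          have "?A l + e \<le> ?A q" using gap1[of v q l e] v 3 kl that by auto
          moreover have "?A k + e \<le> ?A p" using gap1[of v p k e] v 3 pq that by auto
          ultimately show ?thesis using 3 kl False uv Ak unfolding Nx by auto
        qed
      qed
    qed (use u v uv in auto)
  next
    case inner
    then obtain w k l where inner: "w \<in> K" "w < q" "(k, l) \<in> T" "l \<le> w"
      unfolding pair_right_def by auto
    \<comment> \<open>Now the pair lies between \<open>p\<close> and \<open>q\<close>:
      \<open>v\<close> is the last element of \<open>K\<close> before \<open>q\<close> and
      \<open>u\<close> the first one from \<open>p\<close> on. So \<open>p\<close> counts both and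
      \<open>q\<close> counts neither.\<close>
    define v where "v = Max (K \<inter> {..<q})"
    have "K \<inter> {..<q} \<noteq> {}" using inner by auto
    then have v: "v \<in> K" "v < q" and vmax: "\<And>x. x \<in> K \<Longrightarrow> x < q \<Longrightarrow> x \<le> v"
      unfolding v_def using Max_in[of "K \<inter> {..<q}"] Max_ge[of "K \<inter> {..<q}"] fin by auto
    have ex: "\<exists>x\<in>K. p \<le> x \<and> x < k" if "(k, l) \<in> T" "l \<le> v" for k l
    proof (rule ccontr)
      assume "\<not> ?thesis"
      then have "?A p \<le> ?A k" by (intro mono) auto
      moreover have "?A q + a v \<le> ?A l" using gap1[of v l q "a v"] v that by auto
      ultimately show False using dom[OF that(1)] pos[OF v(1)] by auto
    qed
    define u where "u = Min (K \<inter> {p..})"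
    have "K \<inter> {p..} \<noteq> {}" using ex[OF inner(3)] inner vmax by fastforce
    then have u: "u \<in> K" "p \<le> u" and umin: "\<And>x. x \<in> K \<Longrightarrow> p \<le> x \<Longrightarrow> u \<le> x"
      unfolding u_def using Min_in[of "K \<inter> {p..}"] Min_le[of "K \<inter> {p..}"] fin by auto
    have uT: "u < k" if "(k, l) \<in> T" "l \<le> v" for k l
      using ex[OF that] umin by fastforce
    \<comment> \<open>The pair that witnesses \<open>pair_right\<close> gives the chain
      \<open>u < k \<le> l \<le> w \<le> v\<close>.\<close>
    have uv: "u < v" using uT[OF inner(3)] ord[OF inner(3)] inner vmax by fastforce
    have Nx: "N {u, v} x = (if x \<le> u then 1 else 0) + (if x \<le> v then 1 else 0)" for x
      unfolding N_def using uv by (intro tail_sum_one_pair) auto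
    show thesis
    proof (rule goal_pair[of u v])
      show "N {u, v} p + N {u, v} q = 2" using u v uv unfolding Nx by auto
      show "N {u, v} k + N {u, v} l \<le> 2" if "(k, l) \<in> T" for k l
        using uT[OF that] ord[OF that] uv unfolding Nx by (cases "l \<le> v"; auto)
      show "?A k + ?A l + e * (2 - (N {u, v} k + N {u, v} l)) \<le> ?A p + ?A q"
        if "(k, l) \<in> T" "0 \<le> e" "e \<le> a u" "e \<le> a v" for k l e
      proof (cases "l \<le> v")
        case True
        then show ?thesis using uT[OF that(1)] ord[OF that(1)] dom[OF that(1)] uv unfolding Nx by auto
      next
        case False
        have Al: "?A l \<le> ?A q" using vmax False by (intro mono) (meson le_less_trans not_less)
        consider "k \<le> u" | "u < k" "k \<le> v" | "v < k" by force
        then show ?thesis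
        proof cases
          case 1
          then show ?thesis using False uv dom[OF that(1)] unfolding Nx by auto
        next
          case 2
          have "?A k + e \<le> ?A p" using gap1[of u p k e] u 2 that by auto
          then show ?thesis using 2 False uv Al unfolding Nx by auto
        next
          case 3
          \<comment> \<open>The count has dropped from 2 to 0, and both \<open>u\<close> and
            \<open>v\<close> lie from \<open>p\<close> on and before \<open>k\<close>, so their two
            weights make up for it.\<close>
          have "?A k + 2 * e \<le> ?A p" using gap2[of u v p k e] u v uv 3 that by auto
          then show ?thesis using 3 False uv Al unfolding Nx by auto
        qed
      qed
    qed (use u v uv in auto)
  next
    case free
    have free': "w < l" if "w \<in> K" "w < q" "(k, l) \<in> T" for w k l
      using free(2) that unfolding pair_right_def by fastforce
    have free: "w < k" if "w \<in> K" "w < p" "(k, l) \<in> T" for w k l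
      using free(1) that unfolding pair_left_def by fastforce
    obtain w where w: "w \<in> K" using ne by auto
    have Nx: "N {w} x = (if x \<le> w then 1 else 0)" for x
      unfolding N_def by (rule tail_sum_one_single)
    show thesis
    proof (rule result)
      show "N {w} k + N {w} l \<le> N {w} p + N {w} q" if "(k, l) \<in> T" for k l
        using free[OF w _ that] free'[OF w _ that] unfolding Nx by force
      show "?A k + ?A l - e * (N {w} k + N {w} l) \<le> ?A p + ?A q - e * (N {w} p + N {w} q)"
        if kl: "(k, l) \<in> T" and "0 \<le> e" and "\<And>i. i \<in> {w} \<Longrightarrow> e \<le> a i" for k l e
      proof -
        \<comment> \<open>Here the tail sums at \<open>k\<close> and \<open>l\<close> are bounded by
          those at \<open>p\<close> and \<open>q\<close> separately, for every nonnegative weight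
          vector on \<open>K\<close>. This applies to the weights left after \<open>e\<close> is
          taken off at \<open>w\<close>.\<close>
        let ?b = "\<lambda>x. a x - (if x \<in> {w} then e else 0)"
        have "0 \<le> ?b x" if "x \<in> K" for x
          using nn that \<open>\<And>i. i \<in> {w} \<Longrightarrow> e \<le> a i\<close> by auto
        then have "tail_sum K ?b k \<le> tail_sum K ?b p" "tail_sum K ?b l \<le> tail_sum K ?b q"
          using free[OF _ _ kl] free'[OF _ _ kl] by (intro tail_sum_mono[OF fin]; force)+
        moreover have "tail_sum K ?b x = ?A x - e * N {w} x" for x
          unfolding N_def using w by (intro tail_sum_diff_indicator fin) auto
        ultimately have "?A k - e * N {w} k \<le> ?A p - e * N {w} p"
          "?A l - e * N {w} l \<le> ?A q - e * N {w} q" by simp_all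
        then show ?thesis unfolding distrib_left by linarith
      qed
    qed (use w in auto)
  qed
qed

text \<open>Repeated peeling writes the weight vector as a positive combination of indicator vectors
  in the cone, so a property \<open>Q\<close> stable under sums and positive multiples passes from
  these to the linear form with coefficients \<open>g\<close>. Leaving \<open>Q\<close> abstract
  serves the strict and the weak inequality alike.\<close>

lemma peel_induct:
  fixes a g :: "'a::linorder \<Rightarrow> 'b::linordered_field"
  assumes "finite K" "K \<noteq> {}" "\<And>k. k \<in> K \<Longrightarrow> 0 < a k"
    and "p \<le> q" and ord: "\<And>k l. (k, l) \<in> T \<Longrightarrow> k \<le> l"
    and "\<And>k l. (k, l) \<in> T \<Longrightarrow>
      tail_sum K a k + tail_sum K a l \<le> tail_sum K a p + tail_sum K a q"
    and Q_add: "\<And>x y. Q x \<Longrightarrow> Q y \<Longrightarrow> Q (x + y)"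
    and Q_scale: "\<And>c x. 0 < c \<Longrightarrow> Q x \<Longrightarrow> Q (c * x)"
    and small: "\<And>I. I \<subseteq> K \<Longrightarrow> I \<noteq> {} \<Longrightarrow> card I \<le> 2 \<Longrightarrow>
      (\<And>k l. (k, l) \<in> T \<Longrightarrow> tail_sum I (\<lambda>_. 1 :: 'b) k + tail_sum I (\<lambda>_. 1) l
        \<le> tail_sum I (\<lambda>_. 1) p + tail_sum I (\<lambda>_. 1) q) \<Longrightarrow> Q (sum g I)"
  shows "Q (\<Sum>k\<in>K. a k * g k)"
  using assms(1,2,3,6) small
proof (induction "card K" arbitrary: K a rule: less_induct)
  case less
  note fin = less.prems(1) and pos = less.prems(3) and dom = less.prems(4) and small = less.prems(5)
  obtain I where I: "I \<subseteq> K" "I \<noteq> {}" "card I \<le> 2"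
    "\<And>k l. (k, l) \<in> T \<Longrightarrow> tail_sum I (\<lambda>_. 1 :: 'b) k + tail_sum I (\<lambda>_. 1) l
        \<le> tail_sum I (\<lambda>_. 1) p + tail_sum I (\<lambda>_. 1) q"
    and peel: "\<And>k l e. (k, l) \<in> T \<Longrightarrow> 0 \<le> e \<Longrightarrow> (\<And>i. i \<in> I \<Longrightarrow> e \<le> a i) \<Longrightarrow>
      tail_sum K a k + tail_sum K a l - e * (tail_sum I (\<lambda>_. 1) k + tail_sum I (\<lambda>_. 1) l)
        \<le> tail_sum K a p + tail_sum K a q - e * (tail_sum I (\<lambda>_. 1) p + tail_sum I (\<lambda>_. 1) q)"
    using peel_step[OF fin less.prems(2) pos \<open>p \<le> q\<close> ord dom] by blast
  have finI: "finite I" using I fin finite_subset by blast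
  \<comment> \<open>This is the largest multiple of the indicator that keeps the weights
    nonnegative. The index \<open>m\<close> attaining the minimum leaves the support, hence the
    induction on \<open>card K\<close>.\<close>
  define e where "e = Min (a ` I)"
  have "e \<in> a ` I" unfolding e_def using finI I by (intro Min_in) auto
  then obtain m where m: "m \<in> I" "a m = e" by auto
  have e: "0 < e" using m I pos by auto
  have e_le: "e \<le> a i" if "i \<in> I" for i unfolding e_def using finI that by auto
  define a' where "a' = (\<lambda>k. a k - (if k \<in> I then e else 0))"
  define K' where "K' = {k \<in> K. a' k \<noteq> 0}"
  have K': "finite K'" "K' \<subseteq> K" "m \<notin> K'" unfolding K'_def a'_def using fin m by auto
  have a'_pos: "0 < a' k" if "k \<in> K'" for k
    using that e_le[of k] pos[of k] unfolding K'_def a'_def by (auto split: if_splits)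
  have small_I: "Q (e * sum g I)" using I e small by (intro Q_scale) auto
  have "(\<Sum>k\<in>K. a k * g k) = (\<Sum>k\<in>K. a' k * g k + (if k \<in> I then e * g k else 0))"
    by (intro sum.cong) (auto simp: a'_def algebra_simps)
  also have "\<dots> = (\<Sum>k\<in>K. a' k * g k) + e * sum g I"
    using fin I by (simp add: sum.distrib sum.If_cases Int_absorb1 sum_distrib_left)
  also have "(\<Sum>k\<in>K. a' k * g k) = (\<Sum>k\<in>K'. a' k * g k)"
    unfolding K'_def using fin by (intro sum.mono_neutral_right) auto
  finally have split: "(\<Sum>k\<in>K. a k * g k) = (\<Sum>k\<in>K'. a' k * g k) + e * sum g I" .
  show ?case
  \<comment> \<open>\<open>Q 0\<close> is not assumed, as it fails for strict positivity; if nothing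
    remains, the peeled term alone is the whole sum.\<close>
  proof (cases "K' = {}")
    case True
    then show ?thesis using split small_I by simp
  next
    case False
    have smaller: "card K' < card K" using K' m I fin by (intro psubset_card_mono) auto
    have dom': "tail_sum K' a' k + tail_sum K' a' l \<le> tail_sum K' a' p + tail_sum K' a' q"
      if "(k, l) \<in> T" for k l
    proof -
      have "tail_sum K' a' x = tail_sum K a' x" for x
        unfolding tail_sum_def K'_def using fin by (intro sum.mono_neutral_left) auto
      also have "tail_sum K a' x = tail_sum K a x - e * tail_sum I (\<lambda>_. 1) x" for x
        unfolding a'_def using fin I by (intro tail_sum_diff_indicator) auto
      finally have eq: "tail_sum K' a' x = tail_sum K a x - e * tail_sum I (\<lambda>_. 1) x" for x .
      show ?thesis
        using peel[OF that less_imp_le[OF e] e_le] unfolding eq distrib_left by linarith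
    qed
    have "Q (\<Sum>k\<in>K'. a' k * g k)"
    proof (rule less.hyps[OF smaller K'(1) False a'_pos dom'])
      fix I assume "I \<subseteq> K'" "I \<noteq> {}" "card I \<le> 2"
        "\<And>k l. (k, l) \<in> T \<Longrightarrow> tail_sum I (\<lambda>_. 1 :: 'b) k + tail_sum I (\<lambda>_. 1) l
          \<le> tail_sum I (\<lambda>_. 1) p + tail_sum I (\<lambda>_. 1) q"
      with K'(2) show "Q (sum g I)" by (intro small) auto
    qed
    then show ?thesis unfolding split using small_I by (rule Q_add)
  qed
qed

section \<open>Ranks of subbundles\<close>

text \<open>If \<open>k < m\<close>, padding \<open>C\<close> with zero rows gives a singular square
  matrix \<open>D\<close>: its transpose kills \<open>unit_vec m k\<close>. A nonzero kernel vector
  of \<open>D\<close> is then one of \<open>C\<close>.\<close>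

lemma injective_mat_dim_le:
  fixes C :: "'a::field mat"
  assumes C: "C \<in> carrier_mat k m"
    and inj: "\<And>c. c \<in> carrier_vec m \<Longrightarrow> C *\<^sub>v c = 0\<^sub>v k \<Longrightarrow> c = 0\<^sub>v m"
  shows "m \<le> k"
proof (rule ccontr)
  assume "\<not> m \<le> k"
  then have km: "k < m" by simp
  define D where "D = mat m m (\<lambda>(i, j). if i < k then C $$ (i, j) else 0)"
  have D: "D \<in> carrier_mat m m" unfolding D_def by simp
  have "det D\<^sup>T = 0"
  proof (subst det_0_iff_vec_prod_zero)
    show "\<exists>v. v \<in> carrier_vec m \<and> v \<noteq> 0\<^sub>v m \<and> D\<^sup>T *\<^sub>v v = 0\<^sub>v m"
    proof (intro exI conjI)
      show "unit_vec m k \<noteq> (0\<^sub>v m :: 'a vec)" using km by simp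
      show "D\<^sup>T *\<^sub>v unit_vec m k = 0\<^sub>v m"
        using km D by (intro eq_vecI) (auto simp: D_def)
    qed simp
  qed (use D in auto)
  then have "det D = 0" using det_transpose[OF D] by simp
  then obtain v where v: "v \<in> carrier_vec m" "v \<noteq> 0\<^sub>v m" "D *\<^sub>v v = 0\<^sub>v m"
    using det_0_iff_vec_prod_zero[OF D] by auto
  have "C *\<^sub>v v = 0\<^sub>v k"
  proof (rule eq_vecI)
    fix i assume i: "i < dim_vec (0\<^sub>v k :: 'a vec)"
    have "row D i = row C i" using i km C by (intro eq_vecI) (auto simp: D_def)
    moreover have "(D *\<^sub>v v) $ i = 0" using v i km by simp
    ultimately show "(C *\<^sub>v v) $ i = 0\<^sub>v k $ i" using i km C D by simp
  qed (use C in auto)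
  with inj v show False by blast
qed

definition mat_range :: "'a::semiring_0 mat \<Rightarrow> 'a vec set" where
  "mat_range A = {A *\<^sub>v c |c. c \<in> carrier_vec (dim_col A)}"

text \<open>The columns of \<open>C\<close> are preimages under \<open>B\<close> of the columns of
  \<open>A\<close>.\<close>

lemma mat_range_subset_factor:
  fixes A B :: "'a::comm_semiring_1 mat"
  assumes A: "A \<in> carrier_mat r m" and B: "B \<in> carrier_mat r k" and sub: "mat_range A \<subseteq> mat_range B"
  obtains C where "C \<in> carrier_mat k m" "A = B * C"
proof -
  have "\<exists>c\<in>carrier_vec k. col A j = B *\<^sub>v c" if "j < m" for j
  proof -
    have "A *\<^sub>v unit_vec m j = col A j"
      using A that by (intro eq_vecI) auto
    then have "col A j \<in> mat_range A"
      using A unfolding mat_range_def by (metis (mono_tags, lifting) carrier_matD(2) mem_Collect_eq unit_vec_carrier)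
    then show ?thesis using sub B unfolding mat_range_def by auto
  qed
  then obtain c where c: "\<And>j. j < m \<Longrightarrow> c j \<in> carrier_vec k \<and> col A j = B *\<^sub>v c j" by metis
  define C where "C = mat_of_cols k (map c [0..<m])"
  have C: "C \<in> carrier_mat k m" unfolding C_def by (simp add: mat_of_cols_def)
  have "A = B * C"
  proof (rule mat_col_eqI)
    fix j assume "j < dim_col (B * C)"
    then have j: "j < m" using C by simp
    have "col C j = c j" unfolding C_def using c j by (subst col_mat_of_cols) auto
    then show "col A j = col (B * C) j" using c[OF j] col_mult2[OF B C j] by simp
  qed (use A B C in auto)
  with C that show thesis by blast
qed

text \<open>Write \<open>A = B * C\<close>. Injectivity of \<open>A\<close> passes to
  \<open>C\<close>, which bounds \<open>m\<close>; if \<open>m = k\<close>, then \<open>C\<close> is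
  invertible and \<open>B\<close> factors through \<open>A\<close> in turn.\<close>

lemma mat_range_dim:
  fixes A B :: "'a::field mat"
  assumes A: "A \<in> carrier_mat r m" and B: "B \<in> carrier_mat r k" and sub: "mat_range A \<subseteq> mat_range B"
    and inj: "\<And>c. c \<in> carrier_vec m \<Longrightarrow> A *\<^sub>v c = 0\<^sub>v r \<Longrightarrow> c = 0\<^sub>v m"
  shows mat_range_dim_le: "m \<le> k"
    and mat_range_dim_eq: "m = k \<Longrightarrow> mat_range B \<subseteq> mat_range A"
proof -
  obtain C where C: "C \<in> carrier_mat k m" and ABC: "A = B * C"
    using mat_range_subset_factor[OF A B sub] .
  have injC: "c = 0\<^sub>v m" if c: "c \<in> carrier_vec m" "C *\<^sub>v c = 0\<^sub>v k" for c
  proof (rule inj[OF c(1)])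
    have "A *\<^sub>v c = B *\<^sub>v (C *\<^sub>v c)" unfolding ABC using B C c by simp
    moreover have "B *\<^sub>v 0\<^sub>v k = 0\<^sub>v r" using B by (intro eq_vecI) auto
    ultimately show "A *\<^sub>v c = 0\<^sub>v r" using c B by auto
  qed
  show "m \<le> k" using injective_mat_dim_le[OF C injC] .
  show "mat_range B \<subseteq> mat_range A" if mk: "m = k"
  proof
    fix w assume "w \<in> mat_range B"
    then obtain c where c: "c \<in> carrier_vec m" and w: "w = B *\<^sub>v c"
      unfolding mat_range_def using B mk by auto
    have Cs: "C \<in> carrier_mat m m" and Bs: "B \<in> carrier_mat r m" using C B mk by auto
    have "det C \<noteq> 0" using det_0_iff_vec_prod_zero[OF Cs] injC mk by auto
    \<comment> \<open>\<open>undefined\<close> fills the record extension field of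
      \<open>ring_mat\<close>; invertibility does not depend on it.\<close>
    then obtain D where D: "D \<in> carrier_mat m m" "C * D = 1\<^sub>m m"
      using det_non_zero_imp_unit[OF Cs, of undefined] unfolding Units_def ring_mat_def by auto
    have "w = B *\<^sub>v ((C * D) *\<^sub>v c)" unfolding w D using c by simp
    also have "\<dots> = A *\<^sub>v (D *\<^sub>v c)"
      unfolding ABC using Bs Cs D(1) c by (simp add: assoc_mult_mat_vec[of _ _ m _ m])
    finally show "w \<in> mat_range A" unfolding mat_range_def using A D c by auto
  qed
qed

lemma subbundle_of_rank_fibre:
  assumes "subbundle_of_rank S E F m" "i \<in> idx E" "x \<in> chart E i"
  obtains A where "A \<in> carrier_mat (rk E) m" "F i x = mat_range A"
    "\<And>c. c \<in> carrier_vec m \<Longrightarrow> A *\<^sub>v c = 0\<^sub>v (rk E) \<Longrightarrow> c = 0\<^sub>v m"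
proof -
  obtain U f where x: "x \<in> U" and U: "local_frame S E F m (i, U, f)"
    using assms unfolding subbundle_of_rank_def by blast
  then have f: "f x \<in> carrier_mat (rk E) m" unfolding local_frame_def regular_mat_def by auto
  show thesis
  proof (rule that[OF f])
    show "F i x = mat_range (f x)"
      using U x f unfolding local_frame_def mat_range_def by auto
  qed (use U x in \<open>auto simp: local_frame_def\<close>)
qed

text \<open>Comparing the fibres at one point is enough, and a nonempty space provides that
  point.\<close>

lemma subbundle_rank_le:
  assumes "vector_bundle S E" "topspace (topo S) \<noteq> {}"
    and "subbundle_of_rank S E F m" "subbundle_of_rank S E G k" "sub_le E F G"
  shows "m \<le> k"
proof -
  obtain i x where ix: "i \<in> idx E" "x \<in> chart E i"
    using assms(1,2) unfolding vector_bundle_def by blast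
  obtain A where A: "A \<in> carrier_mat (rk E) m" "F i x = mat_range A"
    "\<And>c. c \<in> carrier_vec m \<Longrightarrow> A *\<^sub>v c = 0\<^sub>v (rk E) \<Longrightarrow> c = 0\<^sub>v m"
    using subbundle_of_rank_fibre[OF assms(3) ix] by metis
  obtain B where B: "B \<in> carrier_mat (rk E) k" "G i x = mat_range B"
    using subbundle_of_rank_fibre[OF assms(4) ix] by metis
  have "mat_range A \<subseteq> mat_range B" using assms(5) ix A(2) B(2) unfolding sub_le_def by metis
  from mat_range_dim_le[OF A(1) B(1) this A(3)] show ?thesis .
qed

text \<open>Uniqueness of the rank, needed to evaluate the definite description in
  \<open>sub_rank\<close>, is \<open>subbundle_rank_le\<close> for the inclusion of \<open>F\<close>
  in itself, read in both directions.\<close>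

lemma sub_rank_eq:
  assumes "vector_bundle S E" "topspace (topo S) \<noteq> {}" "subbundle_of_rank S E F m"
  shows "sub_rank S E F = m"
  unfolding sub_rank_def
proof (rule the_equality, rule assms(3))
  fix k assume "subbundle_of_rank S E F k"
  moreover have "sub_le E F F" by (simp add: sub_le_def)
  ultimately show "k = m" using subbundle_rank_le[OF assms(1,2)] assms(3) by (meson antisym)
qed

text \<open>With equal ranks, each inclusion of fibres would be an equality by dimension, against
  \<open>sub_less\<close>.\<close>

lemma sub_rank_strict_mono:
  assumes vb: "vector_bundle S E" "topspace (topo S) \<noteq> {}"
    and "subbundle S E F" "subbundle S E G" "sub_less E F G"
  shows "sub_rank S E F < sub_rank S E G"
proof -
  obtain m k where F: "subbundle_of_rank S E F m" and G: "subbundle_of_rank S E G k"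
    using assms(3,4) unfolding subbundle_def by auto
  have le: "sub_le E F G" and nle: "\<not> sub_le E G F" using assms(5) unfolding sub_less_def by auto
  have "m \<noteq> k"
  proof
    assume "m = k"
    have "G i x \<subseteq> F i x" if ix: "i \<in> idx E" "x \<in> chart E i" for i x
    proof -
      obtain A where A: "A \<in> carrier_mat (rk E) m" "F i x = mat_range A"
        "\<And>c. c \<in> carrier_vec m \<Longrightarrow> A *\<^sub>v c = 0\<^sub>v (rk E) \<Longrightarrow> c = 0\<^sub>v m"
        using subbundle_of_rank_fibre[OF F ix] by metis
      obtain B where B: "B \<in> carrier_mat (rk E) k" "G i x = mat_range B"
        using subbundle_of_rank_fibre[OF G ix] by metis
      have "mat_range A \<subseteq> mat_range B" using le ix A(2) B(2) unfolding sub_le_def by metis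
      from mat_range_dim_eq[OF A(1) B(1) this A(3) \<open>m = k\<close>] show ?thesis using A B by simp
    qed
    with nle show False unfolding sub_le_def by auto
  qed
  with subbundle_rank_le[OF vb F G le] show ?thesis
    using sub_rank_eq[OF vb F] sub_rank_eq[OF vb G] by simp
qed

text \<open>The frame over a chart is \<open>transition E i i\<close>. It equals the identity matrix
  there, and its regularity is part of \<open>vector_bundle\<close>; in a general \<open>S\<close>
  constants need not be regular.\<close>

lemma full_sub_subbundle:
  assumes "vector_bundle S E"
  shows "subbundle_of_rank S E (full_sub E) (rk E)"
  unfolding subbundle_of_rank_def
proof (intro conjI ballI)
  fix i x assume ix: "i \<in> idx E" "x \<in> chart E i"
  have one: "transition E i i y = 1\<^sub>m (rk E)" if "y \<in> chart E i" for y
    using assms ix that unfolding vector_bundle_def by auto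
  have "regular_mat S (chart E i \<inter> chart E i) (rk E) (rk E) (transition E i i)"
    using assms ix unfolding vector_bundle_def by blast
  moreover have "carrier_vec (rk E) = {1\<^sub>m (rk E) *\<^sub>v c |c :: complex vec. c \<in> carrier_vec (rk E)}"
  proof (intro equalityI subsetI)
    fix v :: "complex vec" assume "v \<in> carrier_vec (rk E)"
    then show "v \<in> {1\<^sub>m (rk E) *\<^sub>v c |c. c \<in> carrier_vec (rk E)}"
      by (intro CollectI exI[of _ v]) simp
  qed auto
  moreover have "openin (topo S) (chart E i)" using assms ix unfolding vector_bundle_def by blast
  ultimately have "local_frame S E (full_sub E) (rk E) (i, chart E i, transition E i i)"
    using ix one unfolding local_frame_def full_sub_def by simp
  with ix show "\<exists>U f. x \<in> U \<and> local_frame S E (full_sub E) (rk E) (i, U, f)" by blast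
next
  fix i j x assume ij: "i \<in> idx E" "j \<in> idx E" and x: "x \<in> chart E i \<inter> chart E j"
  have car: "transition E k l x \<in> carrier_mat (rk E) (rk E)" if "k \<in> {i, j}" "l \<in> {i, j}" for k l
    using assms ij x that unfolding vector_bundle_def regular_mat_def by auto
  have "transition E i j x * transition E j i x = transition E i i x"
    "transition E i i x = 1\<^sub>m (rk E)"
    using assms ij x unfolding vector_bundle_def by auto
  then have inv: "transition E i j x * transition E j i x = 1\<^sub>m (rk E)" by simp
  show "full_sub E i x = (*\<^sub>v) (transition E i j x) ` full_sub E j x"
  proof
    show "full_sub E i x \<subseteq> (*\<^sub>v) (transition E i j x) ` full_sub E j x"
    proof
      fix v assume "v \<in> full_sub E i x"
      then have v: "v \<in> carrier_vec (rk E)" unfolding full_sub_def .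
      have "v = transition E i j x *\<^sub>v (transition E j i x *\<^sub>v v)"
        using assoc_mult_mat_vec[OF car[of i j] car[of j i] v] inv v by simp
      moreover have "transition E j i x *\<^sub>v v \<in> carrier_vec (rk E)" using car[of j i] v by auto
      ultimately show "v \<in> (*\<^sub>v) (transition E i j x) ` full_sub E j x"
        unfolding full_sub_def by blast
    qed
  qed (use car[of i j] in \<open>auto simp: full_sub_def\<close>)
qed

section \<open>The decoration on the whole bundle\<close>

lemma kronecker_vec_unit:
  assumes "k < r * s"
  shows "kronecker_vec (unit_vec r (k div s)) (unit_vec s (k mod s)) = unit_vec (r * s) k"
proof (rule eq_vecI)
  fix l assume l: "l < dim_vec (unit_vec (r * s) k :: complex vec)"
  have s: "0 < s" using assms by (cases s) auto
  have "l div s < r" "k div s < r" "l mod s < s" "k mod s < s"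
    using s l assms by (auto simp: less_mult_imp_div_less)
  moreover have "l = k \<longleftrightarrow> l div s = k div s \<and> l mod s = k mod s"
    by (metis div_mult_mod_eq)
  ultimately show "kronecker_vec (unit_vec r (k div s)) (unit_vec s (k mod s)) $ l
      = (unit_vec (r * s) k :: complex vec) $ l"
    using l assms unfolding kronecker_vec_def by auto
qed (simp add: kronecker_vec_def)

text \<open>Every unit vector of the tensor product is a Kronecker product of unit vectors, so these
  products span.\<close>

lemma tensor_sub_full:
  "tensor_sub E E' (full_sub E) (full_sub E') (i, j) x = carrier_vec (rk E * rk E')"
proof -
  interpret vec_space "TYPE(complex)" "rk E * rk E'" .
  let ?K = "{kronecker_vec v w |v w. v \<in> carrier_vec (rk E) \<and> w \<in> carrier_vec (rk E')}"
  have K: "?K \<subseteq> carrier_vec (rk E * rk E')"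
    unfolding kronecker_vec_def by auto
  have "set (unit_vecs (rk E * rk E')) \<subseteq> ?K"
  proof
    fix u assume "u \<in> set (unit_vecs (rk E * rk E') :: complex vec list)"
    then obtain k where "k < rk E * rk E'" "u = unit_vec (rk E * rk E') k"
      unfolding unit_vecs_def by auto
    then show "u \<in> ?K" using kronecker_vec_unit[of k "rk E" "rk E'"] 
      by (metis (mono_tags, lifting) mem_Collect_eq unit_vec_carrier)
  qed
  then have "span (set (unit_vecs (rk E * rk E'))) \<subseteq> span ?K" by (rule span_is_monotone)
  then have "span ?K = carrier_vec (rk E * rk E')"
    using span_unit_vecs_is_carrier span_is_subset2[OF K] by auto
  then show ?thesis unfolding tensor_sub_def full_sub_def by simp
qed

text \<open>This identifies the last pair \<open>(t + 1, t + 1)\<close> of a filtration with the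
  whole source of the decoration, where \<open>\<phi>\<close> is nonzero.\<close>

lemma copies_sub_full:
  "copies_sub b (tensor_bundle E E) (tensor_sub E E (full_sub E) (full_sub E))
    = full_sub (decoration_source b E)"
proof (intro ext)
  fix ij :: "'a \<times> 'a" and x :: 'b
  obtain i j where "ij = (i, j)" by force
  then show "copies_sub b (tensor_bundle E E) (tensor_sub E E (full_sub E) (full_sub E)) ij x
    = full_sub (decoration_source b E) ij x"
    unfolding copies_sub_def full_sub_def[of "decoration_source b E"]
    by (auto simp: tensor_sub_full copies_bundle_def tensor_bundle_def)
qed

section \<open>Filtrations\<close>

lemma sub_less_trans: "sub_less E F G \<Longrightarrow> sub_less E G H \<Longrightarrow> sub_less E F H"
  unfolding sub_less_def sub_le_def by (meson subset_trans)

lemma filtration_less: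
  assumes "filtration S E t F" "i < j" "j \<le> Suc t"
  shows "sub_less E (F i) (F j)"
  using assms(2,3)
proof (induction j)
  case (Suc j)
  have step: "sub_less E (F j) (F (Suc j))" using assms(1) Suc.prems unfolding filtration_def by auto
  show ?case
  proof (cases "i = j")
    case False
    then have "sub_less E (F i) (F j)" using Suc by simp
    then show ?thesis using step by (rule sub_less_trans)
  qed (use step in simp)
qed simp

lemma filtration_subbundle:
  assumes "vector_bundle S E" "filtration S E t F" "i \<in> {1..Suc t}"
  shows "subbundle S E (F i)"
proof (cases "i = Suc t")
  case True
  then have "F i = full_sub E" using assms(2) unfolding filtration_def by simp
  then show ?thesis using full_sub_subbundle[OF assms(1)] unfolding subbundle_def by auto
next
  case False
  then show ?thesis using assms(2,3) unfolding filtration_def by auto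
qed

lemma filtration_rank_less:
  assumes "vector_bundle S E" "topspace (topo S) \<noteq> {}" "filtration S E t F"
    and "i \<in> {1..Suc t}" "j \<in> {1..Suc t}" "i < j"
  shows "sub_rank S E (F i) < sub_rank S E (F j)"
  using assms by (intro sub_rank_strict_mono filtration_subbundle filtration_less) auto

lemma filtration_rank_le_iff:
  assumes "vector_bundle S E" "topspace (topo S) \<noteq> {}" "filtration S E t F"
    and "i \<in> {1..Suc t}" "j \<in> {1..Suc t}"
  shows "sub_rank S E (F i) \<le> sub_rank S E (F j) \<longleftrightarrow> i \<le> j"
  using filtration_rank_less[OF assms] filtration_rank_less[OF assms(1-3,5,4)]
  by (cases i j rule: linorder_cases) auto

lemma filtration_rk_pos:
  assumes "vector_bundle S E" "topspace (topo S) \<noteq> {}" "filtration S E t F"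
  shows "0 < rk E"
proof -
  have "F (Suc t) = full_sub E" "1 \<le> t" using assms(3) unfolding filtration_def by auto
  moreover have "sub_rank S E (full_sub E) = rk E"
    using sub_rank_eq[OF assms(1,2) full_sub_subbundle[OF assms(1)]] .
  ultimately show ?thesis using filtration_rank_less[OF assms, of 1 "Suc t"] by auto
qed

text \<open>Passage to a subfiltration: \<open>\<sigma>\<close> lists the positions that are kept,
  and fixing both ends preserves the padding by zero and by \<open>E\<close>.\<close>

lemma filtration_comp:
  assumes "filtration S E t F" "strict_mono_on {0..Suc s} \<sigma>" "\<sigma> 0 = 0" "\<sigma> (Suc s) = Suc t" "1 \<le> s"
  shows "filtration S E s (F \<circ> \<sigma>)"
proof -
  have less: "\<sigma> i < \<sigma> j" if "i < j" "j \<le> Suc s" for i j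
    using strict_mono_onD[OF assms(2)] that by auto
  have "\<sigma> i \<in> {1..t}" if "i \<in> {1..s}" for i
    using less[of 0 i] less[of i "Suc s"] that assms(3,4) by auto
  moreover have "\<sigma> (Suc i) \<le> Suc t" if "i \<le> s" for i
    using less[of "Suc i" "Suc s"] that assms(4) by (cases "i = s") auto
  ultimately show ?thesis
    using assms(1,3-5) less filtration_less[OF assms(1)] unfolding filtration_def by simp
qed

section \<open>The invariant \<mu> in terms of tail sums\<close>

text \<open>Ranks increase strictly, so the \<open>k\<close>-th summand takes its lower value
  exactly when \<open>i \<le> k\<close>. The subtracted multiples of \<open>rk E\<close> then add up
  to a tail sum.\<close>

lemma gamma_entry_tail_sum:
  assumes "vector_bundle S E" "topspace (topo S) \<noteq> {}" "filtration S E t F" "i \<in> {1..Suc t}"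
  shows "gamma_entry S E t F \<alpha> (sub_rank S E (F i)) =
    (\<Sum>k=1..t. \<alpha> k * of_nat (sub_rank S E (F k))) - of_nat (rk E) * tail_sum {1..t} \<alpha> i"
proof -
  have "gamma_entry S E t F \<alpha> (sub_rank S E (F i)) =
      (\<Sum>k=1..t. \<alpha> k * of_nat (sub_rank S E (F k)) - (if i \<le> k then of_nat (rk E) * \<alpha> k else 0))"
    unfolding gamma_entry_def using filtration_rank_le_iff[OF assms]
    by (intro sum.cong) (auto simp: algebra_simps)
  also have "\<dots> = (\<Sum>k=1..t. \<alpha> k * of_nat (sub_rank S E (F k)))
      - (\<Sum>k\<in>{1..t} \<inter> {i..}. of_nat (rk E) * \<alpha> k)"
    by (simp add: sum_subtractf sum.If_cases atLeast_def)
  finally show ?thesis by (simp add: tail_sum_def sum_distrib_left)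
qed

text \<open>The pairs over which the minimum in \<open>mu_filt\<close> is taken. They do not depend
  on the weights and can be carried from a subfiltration to the filtration.\<close>

definition active_pairs ::
  "nat \<Rightarrow> nat \<Rightarrow> ('j, 'p) vbundle \<Rightarrow> ('i, 'p) vbundle \<Rightarrow> ('i, 'j, 'p) decoration \<Rightarrow>
   nat \<Rightarrow> (nat \<Rightarrow> ('i, 'p) subfamily) \<Rightarrow> (nat \<times> nat) set" where
  "active_pairs b c N E \<phi> t F = {(i, j). i \<in> {1..Suc t} \<and> j \<in> {1..Suc t} \<and>
     nonzero_on (decoration_source b E) (decoration_target c N E) \<phi>
       (copies_sub b (tensor_bundle E E) (tensor_sub E E (F i) (F j)))}"

text \<open>\<open>h\<close> is the negated sum of two entries of \<open>\<gamma>\<close>, so the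
  negated minimum is the maximum of \<open>h\<close> over the active pairs. This set is nonempty: it
  contains \<open>(Suc t, Suc t)\<close> because \<open>\<phi>\<close> is nonzero.\<close>

lemma mu_filt_tail_sum:
  fixes F \<alpha> t S E
  defines "h \<equiv> \<lambda>(i, j). of_nat (rk E) * (tail_sum {1..t} \<alpha> i + tail_sum {1..t} \<alpha> j)
    - 2 * (\<Sum>k=1..t. \<alpha> k * of_nat (sub_rank S E (F k)))"
  assumes dec: "decorated_bundle S b c N E \<phi>" and ne: "topspace (topo S) \<noteq> {}"
    and filt: "filtration S E t F"
  shows mu_filt_ge: "\<And>ij. ij \<in> active_pairs b c N E \<phi> t F \<Longrightarrow> h ij \<le> mu_filt S b c N E \<phi> t F \<alpha>"
    and mu_filt_attained: "\<exists>pq \<in> active_pairs b c N E \<phi> t F. mu_filt S b c N E \<phi> t F \<alpha> = h pq"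
proof -
  let ?T = "active_pairs b c N E \<phi> t F"
  have vb: "vector_bundle S E" using dec unfolding decorated_bundle_def by simp
  have "?T \<subseteq> {1..Suc t} \<times> {1..Suc t}" unfolding active_pairs_def by auto
  then have fin: "finite ?T" by (rule finite_subset) simp
  have "F (Suc t) = full_sub E" using filt unfolding filtration_def by simp
  then have "(Suc t, Suc t) \<in> ?T"
    using dec unfolding active_pairs_def decorated_bundle_def by (simp add: copies_sub_full)
  then have nonempty: "?T \<noteq> {}" by auto
  have "mu_filt S b c N E \<phi> t F \<alpha> = - Min ((\<lambda>(i, j). gamma_entry S E t F \<alpha> (sub_rank S E (F i))
      + gamma_entry S E t F \<alpha> (sub_rank S E (F j))) ` ?T)"
    unfolding mu_filt_def active_pairs_def by (intro arg_cong[where f = "\<lambda>A. - Min A"]) force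
  also have "(\<lambda>(i, j). gamma_entry S E t F \<alpha> (sub_rank S E (F i))
      + gamma_entry S E t F \<alpha> (sub_rank S E (F j))) ` ?T = (\<lambda>ij. - h ij) ` ?T"
    unfolding h_def active_pairs_def using gamma_entry_tail_sum[OF vb ne filt, of _ \<alpha>]
    by (intro image_cong) (auto simp: algebra_simps)
  finally have mu: "mu_filt S b c N E \<phi> t F \<alpha> = - Min ((\<lambda>ij. - h ij) ` ?T)" .
  show "h ij \<le> mu_filt S b c N E \<phi> t F \<alpha>" if "ij \<in> ?T" for ij
  proof -
    have "Min ((\<lambda>ij. - h ij) ` ?T) \<le> - h ij" using fin that by (intro Min_le) auto
    then show ?thesis unfolding mu by simp
  qed
  have "Min ((\<lambda>ij. - h ij) ` ?T) \<in> (\<lambda>ij. - h ij) ` ?T" using fin nonempty by (intro Min_in) auto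
  then show "\<exists>pq \<in> ?T. mu_filt S b c N E \<phi> t F \<alpha> = h pq" unfolding mu by force
qed

section \<open>Reduction to subfiltrations of length at most two\<close>

lemma enumerate_small_subset:
  assumes "I \<subseteq> {1..t}" "I \<noteq> {}" "card I \<le> 2"
  obtains s and \<sigma> :: "nat \<Rightarrow> nat" where "1 \<le> s" "s \<le> 2" "strict_mono_on {0..Suc s} \<sigma>" "\<sigma> 0 = 0"
    "\<sigma> (Suc s) = Suc t" "\<sigma> ` {1..s} = I"
proof -
  have "finite I" using assms(1) finite_subset by blast
  then have "card I = 1 \<or> card I = 2" using assms(2,3) card_gt_0_iff[of I] by linarith
  then show thesis
  proof
    assume "card I = 1"
    then obtain u where I: "I = {u}" by (auto simp: card_1_singleton_iff)
    show thesis
      \<comment> \<open>The default value \<open>Suc t\<close> provides the upper end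
        \<open>\<sigma> (Suc s)\<close>.\<close>
      by (rule that[of 1 "(\<lambda>_. Suc t)(0 := 0, 1 := u)"])
        (use assms(1) I in \<open>auto simp: strict_mono_on_def\<close>)
  next
    assume "card I = 2"
    then obtain x y where "I = {x, y}" "x \<noteq> y" by (auto simp: card_2_iff)
    then obtain u v where I: "I = {u, v}" "u < v" by (metis insert_commute linorder_neqE_nat)
    have "{1..2} = {1, 2 :: nat}" by auto
    then show thesis
      by (intro that[of 2 "(\<lambda>_. Suc t)(0 := 0, 1 := u, 2 := v)"])
        (use assms(1) I in \<open>auto simp: strict_mono_on_def\<close>)
  qed
qed

text \<open>\<open>Q\<close> stands for nonnegativity or positivity. Its monotonicity is needed
  because an indicator vector only bounds the value of its subfiltration from above.\<close>

lemma weighted_filtration_reduction: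
  fixes \<delta> :: rat
  assumes dec: "decorated_bundle S b c N E \<phi>" and ne: "topspace (topo S) \<noteq> {}" and "0 < \<delta>"
    and Q_mono: "\<And>x y. Q x \<Longrightarrow> x \<le> y \<Longrightarrow> Q y"
    and Q_add: "\<And>x y. Q x \<Longrightarrow> Q y \<Longrightarrow> Q (x + y)"
    and Q_scale: "\<And>c x. 0 < c \<Longrightarrow> Q x \<Longrightarrow> Q (c * x)"
    and short: "\<And>t F. filtration S E t F \<Longrightarrow> t \<le> 2 \<Longrightarrow>
      Q (P_filt S E t F (\<lambda>_. 1) + \<delta> * mu_filt S b c N E \<phi> t F (\<lambda>_. 1))"
    and "weighted_filtration S E t F \<alpha>"
  shows "Q (P_filt S E t F \<alpha> + \<delta> * mu_filt S b c N E \<phi> t F \<alpha>)"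
proof -
  have filt: "filtration S E t F" and pos: "\<And>k. k \<in> {1..t} \<Longrightarrow> 0 < \<alpha> k"
    using assms(8) unfolding weighted_filtration_def by auto
  have vb: "vector_bundle S E" using dec unfolding decorated_bundle_def by simp
  have t: "1 \<le> t" using filt unfolding filtration_def by simp
  define r where "r = (of_nat (rk E) :: rat)"
  have r: "0 < r" unfolding r_def using filtration_rk_pos[OF vb ne filt] by simp
  define R where "R k = (of_nat (sub_rank S E (F k)) :: rat)" for k
  define D where "D k = (of_int (bundle_degree S E * int (sub_rank S E (F k))
    - int (rk E) * sub_degree S E (F k)) :: rat)" for k
  let ?A = "active_pairs b c N E \<phi> t F"
  note mu_ge = mu_filt_ge[OF dec ne filt, of _ \<alpha>, folded r_def R_def]
  obtain p0 q0 where pq0: "(p0, q0) \<in> ?A" and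
    mu0: "mu_filt S b c N E \<phi> t F \<alpha> = r * (tail_sum {1..t} \<alpha> p0 + tail_sum {1..t} \<alpha> q0)
      - 2 * (\<Sum>k=1..t. \<alpha> k * R k)"
    using mu_filt_attained[OF dec ne filt, of \<alpha>, folded r_def R_def] by auto
  \<comment> \<open>The active pairs need not be symmetric, but sums of tail sums are; sorting the
    entries meets the order hypotheses of \<open>peel_induct\<close> and changes no
    inequality.\<close>
  define p q where "p = min p0 q0" and "q = max p0 q0"
  define T where "T = (\<lambda>(i, j). (min i j, max i j)) ` ?A"
  have sym: "f (min i j) + f (max i j) = f i + f j" for f :: "nat \<Rightarrow> rat" and i j
    by (simp add: min_def max_def)
  have pq: "p \<le> q" and sym_pq: "f p + f q = f p0 + f q0" for f :: "nat \<Rightarrow> rat"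
    unfolding p_def q_def by (auto simp: sym)
  have mu: "mu_filt S b c N E \<phi> t F \<alpha> = r * (tail_sum {1..t} \<alpha> p + tail_sum {1..t} \<alpha> q)
      - 2 * (\<Sum>k=1..t. \<alpha> k * R k)"
    unfolding sym_pq mu0 ..
  \<comment> \<open>The coefficients of the linear form that agrees with
    \<open>P + \<delta> \<mu>\<close> on the weights for which \<open>(p, q)\<close> is
    maximal.\<close>
  define g where "g k = D k + \<delta> * (r * ((if p \<le> k then 1 else 0) + (if q \<le> k then 1 else 0)) - 2 * R k)" for k
  have tail_if: "tail_sum K a x = (\<Sum>k\<in>K. a k * (if x \<le> k then 1 else 0))"
    if "finite K" for K and a :: "nat \<Rightarrow> rat" and x
    using that by (simp add: tail_sum_def sum.If_cases if_distrib[of "\<lambda>y. _ * y"] atLeast_def cong: if_cong)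
  have g_sum: "(\<Sum>k\<in>K. a k * g k) = (\<Sum>k\<in>K. a k * D k)
      + \<delta> * (r * (tail_sum K a p + tail_sum K a q) - 2 * (\<Sum>k\<in>K. a k * R k))"
    if "finite K" for K a
    unfolding tail_if[OF that] sum_distrib_left sum.distrib[symmetric] sum_subtractf[symmetric]
    by (intro sum.cong) (auto simp: g_def algebra_simps)
  have "Q (\<Sum>k\<in>{1..t}. \<alpha> k * g k)"
  proof (rule peel_induct[where T = T and p = p and q = q, OF _ _ pos pq _ _ Q_add Q_scale])
    show "k \<le> l" if "(k, l) \<in> T" for k l using that unfolding T_def by auto
    show "tail_sum {1..t} \<alpha> k + tail_sum {1..t} \<alpha> l \<le> tail_sum {1..t} \<alpha> p + tail_sum {1..t} \<alpha> q"
      if kl: "(k, l) \<in> T" for k l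
    proof -
      obtain i j where ij: "(i, j) \<in> ?A" "k = min i j" "l = max i j" using kl unfolding T_def by auto
      have "r * (tail_sum {1..t} \<alpha> i + tail_sum {1..t} \<alpha> j) \<le> r * (tail_sum {1..t} \<alpha> p + tail_sum {1..t} \<alpha> q)"
        using mu_ge[OF ij(1)] unfolding mu by simp
      then show ?thesis unfolding ij(2,3) sym using r by simp
    qed
    show "Q (sum g I)" if I: "I \<subseteq> {1..t}" "I \<noteq> {}" "card I \<le> 2"
      and dom: "\<And>k l. (k, l) \<in> T \<Longrightarrow> tail_sum I (\<lambda>_. 1 :: rat) k + tail_sum I (\<lambda>_. 1) l
        \<le> tail_sum I (\<lambda>_. 1) p + tail_sum I (\<lambda>_. 1) q" for I
    proof -
      have finI: "finite I" using I finite_subset by blast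
      obtain s \<sigma> where s: "1 \<le> s" "s \<le> 2" and \<sigma>: "strict_mono_on {0..Suc s} \<sigma>" "\<sigma> 0 = 0"
        "\<sigma> (Suc s) = Suc t" and img: "\<sigma> ` {1..s} = I"
        using enumerate_small_subset[OF I] by metis
      have filt': "filtration S E s (F \<circ> \<sigma>)" using filtration_comp[OF filt \<sigma> s(1)] .
      have inj: "inj_on \<sigma> {1..s}"
        using strict_mono_on_imp_inj_on[OF \<sigma>(1)] by (rule inj_on_subset) auto
      have reindex: "(\<Sum>i=1..s. f (\<sigma> i)) = sum f I" for f :: "nat \<Rightarrow> rat"
        using sum.reindex[OF inj, of f] img by simp
      have P: "P_filt S E s (F \<circ> \<sigma>) (\<lambda>_. 1) = sum D I"
        unfolding reindex[symmetric] P_filt_def D_def by simp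
      obtain p' q' where pq': "(p', q') \<in> active_pairs b c N E \<phi> s (F \<circ> \<sigma>)" and
        mu': "mu_filt S b c N E \<phi> s (F \<circ> \<sigma>) (\<lambda>_. 1) =
          r * (tail_sum {1..s} (\<lambda>_. 1) p' + tail_sum {1..s} (\<lambda>_. 1) q') - 2 * (\<Sum>i=1..s. R (\<sigma> i))"
        using mu_filt_attained[OF dec ne filt', of "\<lambda>_. 1", folded r_def] unfolding R_def by auto
      have in_range: "p' \<in> {1..Suc s}" "q' \<in> {1..Suc s}" using pq' unfolding active_pairs_def by auto
      have \<sigma>_le: "\<sigma> x \<le> \<sigma> y \<longleftrightarrow> x \<le> y" if "x \<in> {1..Suc s}" "y \<in> {1..Suc s}" for x y
        using strict_mono_on_less_eq[OF \<sigma>(1)] that by auto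
      have \<sigma>_range: "\<sigma> x \<in> {1..Suc t}" if "x \<in> {1..Suc s}" for x
        using that \<sigma>_le[of x "Suc s"] strict_mono_onD[OF \<sigma>(1), of 0 x] \<sigma>(2,3) by auto
      \<comment> \<open>Since \<open>\<sigma>\<close> preserves order, unit weights on the
        subfiltration correspond to the indicator vector of \<open>I\<close> on the original
        indices.\<close>
      have tail: "tail_sum {1..s} (\<lambda>_. 1 :: rat) x = tail_sum I (\<lambda>_. 1) (\<sigma> x)" if "x \<in> {1..Suc s}" for x
        unfolding tail_if[OF finI] tail_if[OF finite_atLeastAtMost] reindex[symmetric]
        using \<sigma>_le[OF that] by (intro sum.cong) auto
      \<comment> \<open>A maximal pair of the subfiltration is active in the full one, hence
        dominated by \<open>(p, q)\<close>. Only an inequality results, as \<open>p\<close> or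
        \<open>q\<close> may be missing from the subfiltration.\<close>
      have "(\<sigma> p', \<sigma> q') \<in> ?A"
        using pq' \<sigma>_range[OF in_range(1)] \<sigma>_range[OF in_range(2)] unfolding active_pairs_def by auto
      then have "(min (\<sigma> p') (\<sigma> q'), max (\<sigma> p') (\<sigma> q')) \<in> T" unfolding T_def by force
      from dom[OF this] have "tail_sum I (\<lambda>_. 1) (\<sigma> p') + tail_sum I (\<lambda>_. 1) (\<sigma> q')
          \<le> tail_sum I (\<lambda>_. 1 :: rat) p + tail_sum I (\<lambda>_. 1) q"
        unfolding sym .
      then have "mu_filt S b c N E \<phi> s (F \<circ> \<sigma>) (\<lambda>_. 1)
          \<le> r * (tail_sum I (\<lambda>_. 1) p + tail_sum I (\<lambda>_. 1) q) - 2 * sum R I"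
        unfolding mu' tail[OF in_range(1)] tail[OF in_range(2)] reindex using r by simp
      then have "P_filt S E s (F \<circ> \<sigma>) (\<lambda>_. 1) + \<delta> * mu_filt S b c N E \<phi> s (F \<circ> \<sigma>) (\<lambda>_. 1) \<le> sum g I"
        using g_sum[OF finI, of "\<lambda>_. 1"] \<open>0 < \<delta>\<close> unfolding P by simp
      then show ?thesis using short[OF filt' s(2)] Q_mono by blast
    qed
  qed (use t in auto)
  moreover have "P_filt S E t F \<alpha> = (\<Sum>k=1..t. \<alpha> k * D k)" unfolding P_filt_def D_def ..
  ultimately show ?thesis unfolding g_sum[OF finite_atLeastAtMost] mu by simp
qed

theorem theorem1:
  fixes n g b c :: nat and \<delta> :: rat
    and X :: "ppoint set"
    and E :: "('i, ppoint) vbundle"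
    and N :: "('j, ppoint) vbundle"
    and \<phi> :: "('i, 'j, ppoint) decoration"
  defines "S \<equiv> proj_variety n X"
  assumes "smooth_projective_curve n X"
    and "has_genus n X g" and "g \<ge> 1"
    and "line_bundle S N"
    and "b \<ge> 1" and "\<delta> > 0"
    and "decorated_bundle S b c N E \<phi>"
  shows "(semistable_decorated S \<delta> b c N E \<phi> \<longleftrightarrow>
            (\<forall>t F. filtration S E t F \<and> t \<le> 2 \<longrightarrow>
               P_filt S E t F (\<lambda>_. 1) + \<delta> * mu_filt S b c N E \<phi> t F (\<lambda>_. 1) \<ge> 0)) \<and>
         (stable_decorated S \<delta> b c N E \<phi> \<longleftrightarrow>
            (\<forall>t F. filtration S E t F \<and> t \<le> 2 \<longrightarrow>
               P_filt S E t F (\<lambda>_. 1) + \<delta> * mu_filt S b c N E \<phi> t F (\<lambda>_. 1) > 0))"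
proof -
  \<comment> \<open>The curve has a point, as the comparison of ranks requires.\<close>
  have "closedin (zariski n) X" "X \<noteq> {}"
    using assms(2) unfolding smooth_projective_curve_def irreducible_closed_def by auto
  then have ne: "topspace (topo S) \<noteq> {}"
    unfolding S_def proj_variety_def using closedin_subset by fastforce
  have unit_weights: "weighted_filtration S E t F (\<lambda>_. 1)" if "filtration S E t F" for t F
    using that unfolding weighted_filtration_def by simp
  \<comment> \<open>Unit weights are a special case of positive weights, which gives one direction
    of each equivalence; \<open>reduce\<close> gives the other.\<close>
  note reduce = weighted_filtration_reduction[OF assms(8) ne \<open>\<delta> > 0\<close>]
  show ?thesis
    unfolding semistable_decorated_def stable_decorated_def
    using unit_weights reduce[where Q = "\<lambda>x. 0 \<le> x"] reduce[where Q = "\<lambda>x. 0 < x"]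
    by (intro conjI iffI allI impI) auto
qed

end
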